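(* Let $(\mathcal{C},\otimes,F,G,a,\Phi)$ be a hom-tensor category. Suppose that $\Theta:\mathrm{id}_{\mathcal{C}}\to F$ is a natural isomorphism such that $\Theta_{M\otimes N}=\Theta_M\otimes\Theta_N$ for all objects $M,N\in\mathcal{C}$. For all objects $U,V,W\in\mathcal{C}$ define $b_{U,V,W}:(U\otimes V)\otimes W\to U\otimes(V\otimes W)$ by $$b_{U,V,W}=(\Theta_U^{-1}\otimes\mathrm{id}_{V\otimes W})\circ a_{U,V,W}\circ(\mathrm{id}_{U\otimes V}\otimes\Theta_W).$$ Then $b$ is an associativity constraint, so that $(\mathcal{C},\otimes,b)$ is a pre-tensor category.
   Context: A hom-tensor category is a 6-tuple $(\mathcal{C},\otimes,F,G,a,\Phi)$ where: $\mathcal{C}$ is a category; $\otimes:\mathcal{C}\times\mathcal{C}\to\mathcal{C}$ is a functor; $F,G:\mathcal{C}\to\mathcal{C}$ are functors with $F(U\otimes V)=F(U)\otimes F(V)$, $F(f\otimes g)=F(f)\otimes F(g)$, and likewise $G(U\otimes V)=G(U)\otimes G(V)$, $G(f\otimes g)=G(f)\otimes G(g)$, for all objects $U,V$ and morphisms $f,g$; $FG=GF$; $a_{X,Y,Z}:(X\otimes Y)\otimes F(Z)\to F(X)\otimes(Y\otimes Z)$ is a natural isomorphism satisfying, for all objects $X,Y,Z,T$, $$a_{F(X),F(Y),Z\otimes T}\circ a_{X\otimes Y,F(Z),F(T)}=(\mathrm{id}_{F^2(X)}\otimes a_{Y,Z,T})\circ a_{F(X),Y\otimes Z,F(T)}\circ(a_{X,Y,Z}\otimes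 \mathrm{id}_{F^2(T)});$$ $\Phi:\mathrm{id}_{\mathcal{C}}\to G$ is a natural transformation with $F(\Phi_U)=\Phi_{F(U)}$, $G(\Phi_U)=\Phi_{G(U)}$ and $\Phi_{M\otimes N}=\Phi_M\otimes\Phi_N$ for all objects $U,M,N$. No unit object is required. A pre-tensor category $(\mathcal{C},\otimes,b)$ satisfies all the axioms of a tensor (monoidal) category except that no unit object is required: $\otimes$ is a functor and the associativity constraint $b_{U,V,W}:(U\otimes V)\otimes W\to U\otimes(V\otimes W)$ is a natural isomorphism satisfying the usual pentagon axiom. *)

theory Defs
  imports Main
begin

text \<open>
  A category is given by a set of objects and a set of arrows inside arbitrary types. Values of the
  structure maps outside these sets are unconstrained, so every axiom below is relativised to
  objects and arrows, and functors and natural transformations are only ever compared there.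
\<close>

record ('o, 'm) cat =
  Obj :: "'o set"
  Arr :: "'m set"
  Dom :: "'m \<Rightarrow> 'o"
  Cod :: "'m \<Rightarrow> 'o"
  Ident :: "'o \<Rightarrow> 'm"
  Comp :: "'m \<Rightarrow> 'm \<Rightarrow> 'm"  (infixl "\<cdot>\<index>" 55)

definition Hom :: "('o, 'm) cat \<Rightarrow> 'o \<Rightarrow> 'o \<Rightarrow> 'm set" where
  "Hom C X Y = {f \<in> Arr C. Dom C f = X \<and> Cod C f = Y}"

text \<open>Composition is in applicative order: \<open>g \<cdot>\<^bsub>C\<^esub> f\<close> is \<open>g\<close> after \<open>f\<close>.\<close>

locale category =
  fixes C :: "('o, 'm) cat"
  assumes Dom_Obj: "f \<in> Arr C \<Longrightarrow> Dom C f \<in> Obj C"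
    and Cod_Obj: "f \<in> Arr C \<Longrightarrow> Cod C f \<in> Obj C"
    and Ident_Hom: "X \<in> Obj C \<Longrightarrow> Ident C X \<in> Hom C X X"
    and Comp_Hom: "f \<in> Hom C X Y \<Longrightarrow> g \<in> Hom C Y Z \<Longrightarrow> g \<cdot>\<^bsub>C\<^esub> f \<in> Hom C X Z"
    and Comp_Ident_left: "f \<in> Hom C X Y \<Longrightarrow> Ident C Y \<cdot>\<^bsub>C\<^esub> f = f"
    and Comp_Ident_right: "f \<in> Hom C X Y \<Longrightarrow> f \<cdot>\<^bsub>C\<^esub> Ident C X = f"
    and Comp_assoc: "f \<in> Hom C W X \<Longrightarrow> g \<in> Hom C X Y \<Longrightarrow> h \<in> Hom C Y Z \<Longrightarrow>
      h \<cdot>\<^bsub>C\<^esub> g \<cdot>\<^bsub>C\<^esub> f = h \<cdot>\<^bsub>C\<^esub> (g \<cdot>\<^bsub>C\<^esub> f)"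

definition inverse_arrows :: "('o, 'm) cat \<Rightarrow> 'm \<Rightarrow> 'm \<Rightarrow> bool" where
  "inverse_arrows C f g \<longleftrightarrow>
     f \<in> Arr C \<and> g \<in> Hom C (Cod C f) (Dom C f) \<and>
     g \<cdot>\<^bsub>C\<^esub> f = Ident C (Dom C f) \<and> f \<cdot>\<^bsub>C\<^esub> g = Ident C (Cod C f)"

definition is_iso :: "('o, 'm) cat \<Rightarrow> 'm \<Rightarrow> bool" where
  "is_iso C f \<longleftrightarrow> (\<exists>g. inverse_arrows C f g)"

text \<open>Meaningful only when \<open>is_iso C f\<close> holds.\<close>

definition inv_arr :: "('o, 'm) cat \<Rightarrow> 'm \<Rightarrow> 'm" where
  "inv_arr C f = (THE g. inverse_arrows C f g)"

definition prod_cat :: "('o1, 'm1) cat \<Rightarrow> ('o2, 'm2) cat \<Rightarrow> ('o1 \<times> 'o2, 'm1 \<times> 'm2) cat"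
    (infixr "\<times>\<^sub>C" 80) where
  "C \<times>\<^sub>C D =
     \<lparr>Obj = Obj C \<times> Obj D,
      Arr = Arr C \<times> Arr D,
      Dom = (\<lambda>(f, g). (Dom C f, Dom D g)),
      Cod = (\<lambda>(f, g). (Cod C f, Cod D g)),
      Ident = (\<lambda>(X, Y). (Ident C X, Ident D Y)),
      Comp = (\<lambda>(f', g') (f, g). (f' \<cdot>\<^bsub>C\<^esub> f, g' \<cdot>\<^bsub>D\<^esub> g))\<rparr>"

record ('o1, 'm1, 'o2, 'm2) functor_data =
  omap :: "'o1 \<Rightarrow> 'o2"
  amap :: "'m1 \<Rightarrow> 'm2"

locale is_functor = source: category C + target: category D
  for C :: "('o1, 'm1) cat" and D :: "('o2, 'm2) cat" +
  fixes F :: "('o1, 'm1, 'o2, 'm2) functor_data"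
  assumes omap_Obj: "X \<in> Obj C \<Longrightarrow> omap F X \<in> Obj D"
    and amap_Hom: "f \<in> Hom C X Y \<Longrightarrow> amap F f \<in> Hom D (omap F X) (omap F Y)"
    and amap_Ident: "X \<in> Obj C \<Longrightarrow> amap F (Ident C X) = Ident D (omap F X)"
    and amap_Comp: "f \<in> Hom C X Y \<Longrightarrow> g \<in> Hom C Y Z \<Longrightarrow>
      amap F (g \<cdot>\<^bsub>C\<^esub> f) = amap F g \<cdot>\<^bsub>D\<^esub> amap F f"

definition id_functor :: "('o, 'm, 'o, 'm) functor_data" where
  "id_functor = \<lparr>omap = (\<lambda>X. X), amap = (\<lambda>f. f)\<rparr>"

locale natural_transformation = source: is_functor C D F + target: is_functor C D G
  for C :: "('o1, 'm1) cat" and D :: "('o2, 'm2) cat"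
    and F :: "('o1, 'm1, 'o2, 'm2) functor_data" and G :: "('o1, 'm1, 'o2, 'm2) functor_data" +
  fixes \<tau> :: "'o1 \<Rightarrow> 'm2"
  assumes component_Hom: "X \<in> Obj C \<Longrightarrow> \<tau> X \<in> Hom D (omap F X) (omap G X)"
    and naturality: "f \<in> Hom C X Y \<Longrightarrow> \<tau> Y \<cdot>\<^bsub>D\<^esub> amap F f = amap G f \<cdot>\<^bsub>D\<^esub> \<tau> X"

locale natural_isomorphism = natural_transformation +
  assumes component_iso: "X \<in> Obj C \<Longrightarrow> is_iso D (\<tau> X)"

text \<open>For a functor \<open>T : C \<times> C \<rightarrow> C\<close>, \<open>X \<otimes>\<^bsub>T\<^esub> Y\<close> is the tensor product of objects and
  \<open>f \<boxtimes>\<^bsub>T\<^esub> g\<close> that of arrows.\<close>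

abbreviation tensor_obj ::
    "('o \<times> 'o, 'm \<times> 'm, 'o, 'm) functor_data \<Rightarrow> 'o \<Rightarrow> 'o \<Rightarrow> 'o" (infixl "\<otimes>\<index>" 70) where
  "X \<otimes>\<^bsub>T\<^esub> Y \<equiv> omap T (X, Y)"

abbreviation tensor_arr ::
    "('o \<times> 'o, 'm \<times> 'm, 'o, 'm) functor_data \<Rightarrow> 'm \<Rightarrow> 'm \<Rightarrow> 'm" (infixl "\<boxtimes>\<index>" 70) where
  "f \<boxtimes>\<^bsub>T\<^esub> g \<equiv> amap T (f, g)"

text \<open>
  The functors \<open>(X, Y, Z) \<mapsto> (X \<otimes> Y) \<otimes> F Z\<close> and \<open>(X, Y, Z) \<mapsto> F X \<otimes> (Y \<otimes> Z)\<close> from \<open>C \<times> C \<times> C\<close> to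
  \<open>C\<close>. The ordinary bracketings are the case \<open>F = id_functor\<close>.
\<close>

definition left_bracketing where
  "left_bracketing T F =
     \<lparr>omap = (\<lambda>(X, Y, Z). (X \<otimes>\<^bsub>T\<^esub> Y) \<otimes>\<^bsub>T\<^esub> omap F Z),
      amap = (\<lambda>(f, g, h). (f \<boxtimes>\<^bsub>T\<^esub> g) \<boxtimes>\<^bsub>T\<^esub> amap F h)\<rparr>"

definition right_bracketing where
  "right_bracketing T F =
     \<lparr>omap = (\<lambda>(X, Y, Z). omap F X \<otimes>\<^bsub>T\<^esub> (Y \<otimes>\<^bsub>T\<^esub> Z)),
      amap = (\<lambda>(f, g, h). amap F f \<boxtimes>\<^bsub>T\<^esub> (g \<boxtimes>\<^bsub>T\<^esub> h))\<rparr>"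

locale hom_tensor_category =
  category C +
  tensor: is_functor "C \<times>\<^sub>C C" C T +
  F: is_functor C C F +
  G: is_functor C C G +
  a: natural_isomorphism "C \<times>\<^sub>C C \<times>\<^sub>C C" C "left_bracketing T F" "right_bracketing T F"
    "\<lambda>(X, Y, Z). a X Y Z" +
  \<Phi>: natural_transformation C C id_functor G \<Phi>
  for C :: "('o, 'm) cat"
    and T :: "('o \<times> 'o, 'm \<times> 'm, 'o, 'm) functor_data"
    and F :: "('o, 'm, 'o, 'm) functor_data"
    and G :: "('o, 'm, 'o, 'm) functor_data"
    and a :: "'o \<Rightarrow> 'o \<Rightarrow> 'o \<Rightarrow> 'm"
    and \<Phi> :: "'o \<Rightarrow> 'm" +
  assumes F_tensor_obj: "U \<in> Obj C \<Longrightarrow> V \<in> Obj C \<Longrightarrow>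
      omap F (U \<otimes>\<^bsub>T\<^esub> V) = omap F U \<otimes>\<^bsub>T\<^esub> omap F V"
    and F_tensor_arr: "f \<in> Arr C \<Longrightarrow> g \<in> Arr C \<Longrightarrow>
      amap F (f \<boxtimes>\<^bsub>T\<^esub> g) = amap F f \<boxtimes>\<^bsub>T\<^esub> amap F g"
    and G_tensor_obj: "U \<in> Obj C \<Longrightarrow> V \<in> Obj C \<Longrightarrow>
      omap G (U \<otimes>\<^bsub>T\<^esub> V) = omap G U \<otimes>\<^bsub>T\<^esub> omap G V"
    and G_tensor_arr: "f \<in> Arr C \<Longrightarrow> g \<in> Arr C \<Longrightarrow>
      amap G (f \<boxtimes>\<^bsub>T\<^esub> g) = amap G f \<boxtimes>\<^bsub>T\<^esub> amap G g"
    and FG_obj: "U \<in> Obj C \<Longrightarrow> omap F (omap G U) = omap G (omap F U)"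
    and FG_arr: "f \<in> Arr C \<Longrightarrow> amap F (amap G f) = amap G (amap F f)"
    and hom_pentagon:
      "X \<in> Obj C \<Longrightarrow> Y \<in> Obj C \<Longrightarrow> Z \<in> Obj C \<Longrightarrow> W \<in> Obj C \<Longrightarrow>
        a (omap F X) (omap F Y) (Z \<otimes>\<^bsub>T\<^esub> W) \<cdot>\<^bsub>C\<^esub> a (X \<otimes>\<^bsub>T\<^esub> Y) (omap F Z) (omap F W) =
        (Ident C (omap F (omap F X)) \<boxtimes>\<^bsub>T\<^esub> a Y Z W)
          \<cdot>\<^bsub>C\<^esub> a (omap F X) (Y \<otimes>\<^bsub>T\<^esub> Z) (omap F W)
          \<cdot>\<^bsub>C\<^esub> (a X Y Z \<boxtimes>\<^bsub>T\<^esub> Ident C (omap F (omap F W)))"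
    and F_\<Phi>: "U \<in> Obj C \<Longrightarrow> amap F (\<Phi> U) = \<Phi> (omap F U)"
    and G_\<Phi>: "U \<in> Obj C \<Longrightarrow> amap G (\<Phi> U) = \<Phi> (omap G U)"
    and \<Phi>_tensor: "M \<in> Obj C \<Longrightarrow> N \<in> Obj C \<Longrightarrow> \<Phi> (M \<otimes>\<^bsub>T\<^esub> N) = \<Phi> M \<boxtimes>\<^bsub>T\<^esub> \<Phi> N"

locale associativity_constraint =
  natural_isomorphism "C \<times>\<^sub>C C \<times>\<^sub>C C" C
    "left_bracketing T id_functor" "right_bracketing T id_functor" "\<lambda>(U, V, W). b U V W"
  for C :: "('o, 'm) cat"
    and T :: "('o \<times> 'o, 'm \<times> 'm, 'o, 'm) functor_data"
    and b :: "'o \<Rightarrow> 'o \<Rightarrow> 'o \<Rightarrow> 'm" +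
  assumes pentagon:
    "U \<in> Obj C \<Longrightarrow> V \<in> Obj C \<Longrightarrow> W \<in> Obj C \<Longrightarrow> X \<in> Obj C \<Longrightarrow>
      b U V (W \<otimes>\<^bsub>T\<^esub> X) \<cdot>\<^bsub>C\<^esub> b (U \<otimes>\<^bsub>T\<^esub> V) W X =
      (Ident C U \<boxtimes>\<^bsub>T\<^esub> b V W X) \<cdot>\<^bsub>C\<^esub> b U (V \<otimes>\<^bsub>T\<^esub> W) X \<cdot>\<^bsub>C\<^esub> (b U V W \<boxtimes>\<^bsub>T\<^esub> Ident C X)"

locale pre_tensor_category =
  category C +
  tensor: is_functor "C \<times>\<^sub>C C" C T +
  b: associativity_constraint C T b
  for C :: "('o, 'm) cat"
    and T :: "('o \<times> 'o, 'm \<times> 'm, 'o, 'm) functor_data"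
    and b :: "'o \<Rightarrow> 'o \<Rightarrow> 'o \<Rightarrow> 'm"

end

theory Submission
  imports Defs
begin

text \<open>
  Write \<open>\<Theta>\<close> for the natural isomorphism \<open>id \<rightarrow> F\<close>. The arrow \<open>b U V W\<close> is the only one for which

    \<open>(\<Theta> U \<otimes> id) \<circ> b U V W = a U V W \<circ> (id \<otimes> \<Theta> W)\<close>,

  and the argument uses \<open>b\<close> only through this square (\<open>b_square\<close>), so that no inverse of \<open>\<Theta>\<close> has to
  be moved through a composite. As \<open>\<Theta> U \<otimes> id\<close> is invertible, naturality of \<open>b\<close> follows from
  that of \<open>a\<close> and \<open>\<Theta>\<close>, and \<open>b\<close> is invertible as a composite of isomorphisms.

  For the pentagon, \<open>\<Theta>\<close> transports both sides for \<open>b\<close> to the two sides for \<open>a\<close>. Put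
  \<open>P = (id \<otimes> \<Theta> W) \<otimes> (\<Theta> (F X) \<circ> \<Theta> X)\<close> and \<open>Q = (\<Theta> (F U) \<circ> \<Theta> U) \<otimes> (\<Theta> V \<otimes> id)\<close>. These
  connect the ends \<open>((U \<otimes> V) \<otimes> W) \<otimes> X\<close> and \<open>U \<otimes> (V \<otimes> (W \<otimes> X))\<close> of the ordinary pentagon with the
  ends \<open>((U \<otimes> V) \<otimes> F W) \<otimes> F (F X)\<close> and \<open>F (F U) \<otimes> (F V \<otimes> (W \<otimes> X))\<close> of the twisted one. Replacing
  one \<open>b\<close> after the other by means of the square shows \<open>Q \<circ> side_b = side_a \<circ> P\<close> on each
  side. The factors \<open>\<Theta>\<close> pass the remaining \<open>a\<close> by naturality of \<open>a\<close>, because \<open>\<Theta> (F X) = F (\<Theta> X)\<close>;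
  on the side with two arrows multiplicativity of \<open>\<Theta>\<close> is used as well, to split \<open>\<Theta> (U \<otimes> V)\<close> and
  \<open>\<Theta> (W \<otimes> X)\<close>. The pentagon for \<open>a\<close> then makes the two sides for \<open>b\<close> agree after composition with
  the isomorphism \<open>Q\<close>.
\<close>

section \<open>Arrows and isomorphisms\<close>

text \<open>
  The category axioms are stated with hom-sets. The forms below, with separate conditions on \<open>Arr\<close>,
  \<open>Dom\<close> and \<open>Cod\<close>, let the simplifier discharge all typing conditions and bring composites into
  right-nested form.
\<close>

context category
begin

lemma Ident_arr [simp]:
  assumes "X \<in> Obj C"
  shows "Ident C X \<in> Arr C" "Dom C (Ident C X) = X" "Cod C (Ident C X) = X"
  using Ident_Hom[OF assms] by (auto simp: Hom_def)

lemma Comp_arr [simp]: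
  assumes "f \<in> Arr C" "g \<in> Arr C" "Dom C g = Cod C f"
  shows "g \<cdot>\<^bsub>C\<^esub> f \<in> Arr C" "Dom C (g \<cdot>\<^bsub>C\<^esub> f) = Dom C f" "Cod C (g \<cdot>\<^bsub>C\<^esub> f) = Cod C g"
  using Comp_Hom[of f "Dom C f" "Cod C f" g "Cod C g"] assms by (auto simp: Hom_def)

lemma Ident_Comp_arr [simp]:
  assumes "f \<in> Arr C"
  shows "Cod C f = X \<Longrightarrow> Ident C X \<cdot>\<^bsub>C\<^esub> f = f" "Dom C f = X \<Longrightarrow> f \<cdot>\<^bsub>C\<^esub> Ident C X = f"
  using Comp_Ident_left[of f "Dom C f" X] Comp_Ident_right[of f X "Cod C f"] assms
  by (auto simp: Hom_def)

lemma Comp_assoc_arr: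
  assumes "f \<in> Arr C" "g \<in> Arr C" "h \<in> Arr C" "Dom C g = Cod C f" "Dom C h = Cod C g"
  shows "h \<cdot>\<^bsub>C\<^esub> g \<cdot>\<^bsub>C\<^esub> f = h \<cdot>\<^bsub>C\<^esub> (g \<cdot>\<^bsub>C\<^esub> f)"
  using Comp_assoc[of f "Dom C f" "Cod C f" g "Cod C g" h "Cod C h"] assms by (auto simp: Hom_def)

lemma inverse_arrows_unique:
  assumes "inverse_arrows C f g" "inverse_arrows C f h"
  shows "g = h"
proof -
  have "g = g \<cdot>\<^bsub>C\<^esub> (f \<cdot>\<^bsub>C\<^esub> h)" using assms by (simp add: inverse_arrows_def Hom_def)
  also have "\<dots> = g \<cdot>\<^bsub>C\<^esub> f \<cdot>\<^bsub>C\<^esub> h"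
    by (rule Comp_assoc_arr[symmetric]) (use assms in \<open>simp_all add: inverse_arrows_def Hom_def\<close>)
  also have "\<dots> = h" using assms by (simp add: inverse_arrows_def Hom_def)
  finally show ?thesis .
qed

lemma inverse_arrows_inv_arr: "is_iso C f \<Longrightarrow> inverse_arrows C f (inv_arr C f)"
  unfolding is_iso_def inv_arr_def by (metis inverse_arrows_unique theI)

lemma inv_arr_simps [simp]:
  assumes "is_iso C f"
  shows "inv_arr C f \<in> Arr C" "Dom C (inv_arr C f) = Cod C f" "Cod C (inv_arr C f) = Dom C f"
    "inv_arr C f \<cdot>\<^bsub>C\<^esub> f = Ident C (Dom C f)" "f \<cdot>\<^bsub>C\<^esub> inv_arr C f = Ident C (Cod C f)"
  using inverse_arrows_inv_arr[OF assms] by (auto simp: inverse_arrows_def Hom_def)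

lemma is_iso_Arr: "is_iso C f \<Longrightarrow> f \<in> Arr C"
  by (auto simp: is_iso_def inverse_arrows_def)

lemma is_isoI:
  assumes "f \<in> Arr C" "g \<in> Arr C" "Dom C g = Cod C f" "Cod C g = Dom C f"
    "g \<cdot>\<^bsub>C\<^esub> f = Ident C (Dom C f)" "f \<cdot>\<^bsub>C\<^esub> g = Ident C (Cod C f)"
  shows "is_iso C f"
  using assms by (auto simp: is_iso_def inverse_arrows_def Hom_def)

lemma is_iso_Ident: "X \<in> Obj C \<Longrightarrow> is_iso C (Ident C X)"
  by (rule is_isoI[where g = "Ident C X"]) simp_all

lemma is_iso_inv_arr: "is_iso C f \<Longrightarrow> is_iso C (inv_arr C f)"
  by (rule is_isoI[where g = f]) (simp_all add: is_iso_Arr)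

lemma iso_cancel_left:
  assumes "is_iso C f" "g \<in> Arr C" "h \<in> Arr C" "Cod C g = Dom C f" "Cod C h = Dom C f"
    and "f \<cdot>\<^bsub>C\<^esub> g = f \<cdot>\<^bsub>C\<^esub> h"
  shows "g = h"
proof -
  have "inv_arr C f \<cdot>\<^bsub>C\<^esub> f \<cdot>\<^bsub>C\<^esub> g = inv_arr C f \<cdot>\<^bsub>C\<^esub> f \<cdot>\<^bsub>C\<^esub> h"
    using assms is_iso_Arr[of f] by (simp add: Comp_assoc_arr del: inv_arr_simps(4))
  then show ?thesis using assms by simp
qed

lemma iso_cancel_right:
  assumes "is_iso C f" "g \<in> Arr C" "h \<in> Arr C" "Dom C g = Cod C f" "Dom C h = Cod C f"
    and "g \<cdot>\<^bsub>C\<^esub> f = h \<cdot>\<^bsub>C\<^esub> f"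
  shows "g = h"
proof -
  have "g \<cdot>\<^bsub>C\<^esub> (f \<cdot>\<^bsub>C\<^esub> inv_arr C f) = h \<cdot>\<^bsub>C\<^esub> (f \<cdot>\<^bsub>C\<^esub> inv_arr C f)"
    using assms is_iso_Arr[of f]
    by (simp add: Comp_assoc_arr[symmetric] del: inv_arr_simps(5))
  then show ?thesis using assms by simp
qed

lemma is_iso_Comp:
  assumes "is_iso C f" "is_iso C g" "Dom C g = Cod C f"
  shows "is_iso C (g \<cdot>\<^bsub>C\<^esub> f)"
proof (rule is_isoI[where g = "inv_arr C f \<cdot>\<^bsub>C\<^esub> inv_arr C g"])
  note [simp] = assms is_iso_Arr[OF assms(1)] is_iso_Arr[OF assms(2)]
  have "inv_arr C g \<cdot>\<^bsub>C\<^esub> (g \<cdot>\<^bsub>C\<^esub> f) = f"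
    by (simp add: Comp_assoc_arr[symmetric])
  then show "inv_arr C f \<cdot>\<^bsub>C\<^esub> inv_arr C g \<cdot>\<^bsub>C\<^esub> (g \<cdot>\<^bsub>C\<^esub> f) = Ident C (Dom C (g \<cdot>\<^bsub>C\<^esub> f))"
    by (simp add: Comp_assoc_arr)
  have "f \<cdot>\<^bsub>C\<^esub> (inv_arr C f \<cdot>\<^bsub>C\<^esub> inv_arr C g) = inv_arr C g"
    by (simp add: Comp_assoc_arr[symmetric])
  then show "g \<cdot>\<^bsub>C\<^esub> f \<cdot>\<^bsub>C\<^esub> (inv_arr C f \<cdot>\<^bsub>C\<^esub> inv_arr C g) = Ident C (Cod C (g \<cdot>\<^bsub>C\<^esub> f))"
    by (simp add: Comp_assoc_arr)
qed (use assms is_iso_Arr in simp_all)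

end

context is_functor
begin

lemma amap_arr [simp]:
  assumes "f \<in> Arr C"
  shows "amap F f \<in> Arr D" "Dom D (amap F f) = omap F (Dom C f)"
    "Cod D (amap F f) = omap F (Cod C f)"
  using amap_Hom[of f "Dom C f" "Cod C f"] assms by (auto simp: Hom_def)

end

lemma Obj_prod_cat [simp]: "Obj (C \<times>\<^sub>C D) = Obj C \<times> Obj D"
  by (simp add: prod_cat_def)

lemma Hom_prod_cat: "Hom (C \<times>\<^sub>C D) (X, X') (Y, Y') = Hom C X Y \<times> Hom D X' Y'"
  by (auto simp: Hom_def prod_cat_def)

lemma Ident_prod_cat [simp]: "Ident (C \<times>\<^sub>C D) (X, Y) = (Ident C X, Ident D Y)"
  by (simp add: prod_cat_def)

lemma Comp_prod_cat [simp]: "(f', g') \<cdot>\<^bsub>C \<times>\<^sub>C D\<^esub> (f, g) = (f' \<cdot>\<^bsub>C\<^esub> f, g' \<cdot>\<^bsub>D\<^esub> g)"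
  by (simp add: prod_cat_def)

lemma category_prod_cat:
  assumes "category C" "category D"
  shows "category (C \<times>\<^sub>C D)"
proof -
  interpret C: category C by fact
  interpret D: category D by fact
  show ?thesis
    by unfold_locales
      (auto simp: prod_cat_def Hom_def C.Dom_Obj D.Dom_Obj C.Cod_Obj D.Cod_Obj
        C.Comp_assoc_arr D.Comp_assoc_arr)
qed

section \<open>Tensor products of arrows\<close>

locale tensor_functor = category C + tensor: is_functor "C \<times>\<^sub>C C" C T
  for C :: "('o, 'm) cat" and T :: "('o \<times> 'o, 'm \<times> 'm, 'o, 'm) functor_data"
begin

lemma tensor_Obj [simp]: "X \<in> Obj C \<Longrightarrow> Y \<in> Obj C \<Longrightarrow> X \<otimes>\<^bsub>T\<^esub> Y \<in> Obj C"
  by (simp add: tensor.omap_Obj)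

lemma tensor_arr [simp]:
  assumes "f \<in> Arr C" "g \<in> Arr C"
  shows "f \<boxtimes>\<^bsub>T\<^esub> g \<in> Arr C" "Dom C (f \<boxtimes>\<^bsub>T\<^esub> g) = Dom C f \<otimes>\<^bsub>T\<^esub> Dom C g"
    "Cod C (f \<boxtimes>\<^bsub>T\<^esub> g) = Cod C f \<otimes>\<^bsub>T\<^esub> Cod C g"
  using tensor.amap_arr[of "(f, g)"] assms by (auto simp: prod_cat_def)

lemma tensor_Ident [simp]:
  "X \<in> Obj C \<Longrightarrow> Y \<in> Obj C \<Longrightarrow> Ident C X \<boxtimes>\<^bsub>T\<^esub> Ident C Y = Ident C (X \<otimes>\<^bsub>T\<^esub> Y)"
  using tensor.amap_Ident[of "(X, Y)"] by simp

lemma interchange: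
  assumes "f \<in> Arr C" "g \<in> Arr C" "f' \<in> Arr C" "g' \<in> Arr C"
    "Dom C f' = Cod C f" "Dom C g' = Cod C g"
  shows "(f' \<boxtimes>\<^bsub>T\<^esub> g') \<cdot>\<^bsub>C\<^esub> (f \<boxtimes>\<^bsub>T\<^esub> g) = (f' \<cdot>\<^bsub>C\<^esub> f) \<boxtimes>\<^bsub>T\<^esub> (g' \<cdot>\<^bsub>C\<^esub> g)"
  using tensor.amap_Comp[of "(f, g)" "(Dom C f, Dom C g)" "(Cod C f, Cod C g)" "(f', g')"
      "(Cod C f', Cod C g')"] assms
  by (simp add: Hom_prod_cat) (simp add: Hom_def)

text \<open>
  The interchange law inside a longer right-nested composite, where another arrow precedes
  \<open>f \<boxtimes> g\<close>.
\<close>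

lemma interchange_Comp:
  assumes "f \<in> Arr C" "g \<in> Arr C" "f' \<in> Arr C" "g' \<in> Arr C"
    "Dom C f' = Cod C f" "Dom C g' = Cod C g"
    and "h \<in> Arr C" "Cod C h = Dom C f \<otimes>\<^bsub>T\<^esub> Dom C g"
  shows "(f' \<boxtimes>\<^bsub>T\<^esub> g') \<cdot>\<^bsub>C\<^esub> ((f \<boxtimes>\<^bsub>T\<^esub> g) \<cdot>\<^bsub>C\<^esub> h) = ((f' \<cdot>\<^bsub>C\<^esub> f) \<boxtimes>\<^bsub>T\<^esub> (g' \<cdot>\<^bsub>C\<^esub> g)) \<cdot>\<^bsub>C\<^esub> h"
  using assms by (simp add: interchange Comp_assoc_arr[symmetric])

lemma is_iso_tensor:
  assumes "is_iso C f" "is_iso C g"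
  shows "is_iso C (f \<boxtimes>\<^bsub>T\<^esub> g)"
  by (rule is_isoI[where g = "inv_arr C f \<boxtimes>\<^bsub>T\<^esub> inv_arr C g"])
    (use assms in \<open>simp_all add: is_iso_Arr interchange Dom_Obj Cod_Obj\<close>)

lemma functor_left_bracketing:
  assumes "is_functor C C H"
  shows "is_functor (C \<times>\<^sub>C C \<times>\<^sub>C C) C (left_bracketing T H)"
proof -
  interpret H: is_functor C C H by fact
  interpret C3: category "C \<times>\<^sub>C C \<times>\<^sub>C C"
    by (intro category_prod_cat category_axioms)
  show ?thesis
    by unfold_locales
      (auto simp: left_bracketing_def Hom_prod_cat H.omap_Obj H.amap_Ident H.amap_Comp,
       auto simp: Hom_def interchange H.amap_Comp)
qed

lemma functor_right_bracketing:
  assumes "is_functor C C H"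
  shows "is_functor (C \<times>\<^sub>C C \<times>\<^sub>C C) C (right_bracketing T H)"
proof -
  interpret H: is_functor C C H by fact
  interpret C3: category "C \<times>\<^sub>C C \<times>\<^sub>C C"
    by (intro category_prod_cat category_axioms)
  show ?thesis
    by unfold_locales
      (auto simp: right_bracketing_def Hom_prod_cat H.omap_Obj H.amap_Ident H.amap_Comp,
       auto simp: Hom_def interchange H.amap_Comp)
qed

end

section \<open>Untwisting the associator\<close>

locale untwisted_hom_tensor_category =
  hom_tensor_category C T F G a \<Phi> +
  \<Theta>: natural_isomorphism C C id_functor F \<Theta>
  for C :: "('o, 'm) cat"
    and T :: "('o \<times> 'o, 'm \<times> 'm, 'o, 'm) functor_data"
    and F G :: "('o, 'm, 'o, 'm) functor_data"
    and a :: "'o \<Rightarrow> 'o \<Rightarrow> 'o \<Rightarrow> 'm"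
    and \<Phi> \<Theta> :: "'o \<Rightarrow> 'm" +
  fixes b :: "'o \<Rightarrow> 'o \<Rightarrow> 'o \<Rightarrow> 'm"
  assumes \<Theta>_tensor: "M \<in> Obj C \<Longrightarrow> N \<in> Obj C \<Longrightarrow> \<Theta> (M \<otimes>\<^bsub>T\<^esub> N) = \<Theta> M \<boxtimes>\<^bsub>T\<^esub> \<Theta> N"
    and b_eq: "U \<in> Obj C \<Longrightarrow> V \<in> Obj C \<Longrightarrow> W \<in> Obj C \<Longrightarrow>
      b U V W = (inv_arr C (\<Theta> U) \<boxtimes>\<^bsub>T\<^esub> Ident C (V \<otimes>\<^bsub>T\<^esub> W))
        \<cdot>\<^bsub>C\<^esub> a U V W \<cdot>\<^bsub>C\<^esub> (Ident C (U \<otimes>\<^bsub>T\<^esub> V) \<boxtimes>\<^bsub>T\<^esub> \<Theta> W)"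
begin

sublocale tensor_functor C T ..

lemma F_Obj [simp]: "X \<in> Obj C \<Longrightarrow> omap F X \<in> Obj C"
  by (rule F.omap_Obj)

lemma \<Theta>_iso [simp]: "X \<in> Obj C \<Longrightarrow> is_iso C (\<Theta> X)"
  by (rule \<Theta>.component_iso)

lemma \<Theta>_arr [simp]:
  assumes "X \<in> Obj C"
  shows "\<Theta> X \<in> Arr C" "Dom C (\<Theta> X) = X" "Cod C (\<Theta> X) = omap F X"
  using \<Theta>.component_Hom[OF assms] by (auto simp: Hom_def id_functor_def)

lemma \<Theta>_natural: "f \<in> Arr C \<Longrightarrow> \<Theta> (Cod C f) \<cdot>\<^bsub>C\<^esub> f = amap F f \<cdot>\<^bsub>C\<^esub> \<Theta> (Dom C f)"
  using \<Theta>.naturality[of f "Dom C f" "Cod C f"] by (simp add: Hom_def id_functor_def)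

text \<open>Naturality of \<open>\<Theta>\<close> at the arrow \<open>\<Theta> X\<close>, which is epic.\<close>

lemma F_\<Theta>:
  assumes "X \<in> Obj C"
  shows "amap F (\<Theta> X) = \<Theta> (omap F X)"
  by (rule iso_cancel_right[of "\<Theta> X"]) (use \<Theta>_natural[of "\<Theta> X"] assms in simp_all)

lemma a_arr [simp]:
  assumes "X \<in> Obj C" "Y \<in> Obj C" "Z \<in> Obj C"
  shows "a X Y Z \<in> Arr C" "Dom C (a X Y Z) = (X \<otimes>\<^bsub>T\<^esub> Y) \<otimes>\<^bsub>T\<^esub> omap F Z"
    "Cod C (a X Y Z) = omap F X \<otimes>\<^bsub>T\<^esub> (Y \<otimes>\<^bsub>T\<^esub> Z)"
  using a.component_Hom[of "(X, Y, Z)"] assms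
  by (auto simp: Hom_def left_bracketing_def right_bracketing_def)

lemma a_natural:
  assumes "f \<in> Arr C" "g \<in> Arr C" "h \<in> Arr C"
    "Dom C f = X" "Dom C g = Y" "Dom C h = Z"
  shows "(amap F f \<boxtimes>\<^bsub>T\<^esub> (g \<boxtimes>\<^bsub>T\<^esub> h)) \<cdot>\<^bsub>C\<^esub> a X Y Z =
    a (Cod C f) (Cod C g) (Cod C h) \<cdot>\<^bsub>C\<^esub> ((f \<boxtimes>\<^bsub>T\<^esub> g) \<boxtimes>\<^bsub>T\<^esub> amap F h)"
  using a.naturality[of "(f, g, h)" "(X, Y, Z)" "(Cod C f, Cod C g, Cod C h)"] assms
  by (simp add: Hom_prod_cat left_bracketing_def right_bracketing_def) (simp add: Hom_def)

lemma a_iso: "X \<in> Obj C \<Longrightarrow> Y \<in> Obj C \<Longrightarrow> Z \<in> Obj C \<Longrightarrow> is_iso C (a X Y Z)"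
  using a.component_iso[of "(X, Y, Z)"] by simp

lemma b_arr [simp]:
  assumes "U \<in> Obj C" "V \<in> Obj C" "W \<in> Obj C"
  shows "b U V W \<in> Arr C" "Dom C (b U V W) = (U \<otimes>\<^bsub>T\<^esub> V) \<otimes>\<^bsub>T\<^esub> W"
    "Cod C (b U V W) = U \<otimes>\<^bsub>T\<^esub> (V \<otimes>\<^bsub>T\<^esub> W)"
  using assms by (simp_all add: b_eq)

lemma b_iso:
  assumes "U \<in> Obj C" "V \<in> Obj C" "W \<in> Obj C"
  shows "is_iso C (b U V W)"
  unfolding b_eq[OF assms] using assms
  by (intro is_iso_Comp is_iso_tensor is_iso_inv_arr is_iso_Ident a_iso \<Theta>_iso) simp_all

lemma b_square:
  assumes "U \<in> Obj C" "V \<in> Obj C" "W \<in> Obj C"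
  shows "(\<Theta> U \<boxtimes>\<^bsub>T\<^esub> Ident C (V \<otimes>\<^bsub>T\<^esub> W)) \<cdot>\<^bsub>C\<^esub> b U V W =
    a U V W \<cdot>\<^bsub>C\<^esub> (Ident C (U \<otimes>\<^bsub>T\<^esub> V) \<boxtimes>\<^bsub>T\<^esub> \<Theta> W)"
  using assms by (simp add: b_eq Comp_assoc_arr interchange_Comp)

text \<open>
  The form in which the square is used: any arrow out of \<open>F U \<otimes> (V \<otimes> W)\<close> of the shape \<open>f \<boxtimes> g\<close> may
  follow, so that \<open>\<Theta> U\<close> need not be split off from a tensor product first.
\<close>

lemma b_square_Comp:
  assumes "U \<in> Obj C" "V \<in> Obj C" "W \<in> Obj C"
    and "f \<in> Arr C" "g \<in> Arr C" "Dom C f = omap F U" "Dom C g = V \<otimes>\<^bsub>T\<^esub> W"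
  shows "((f \<cdot>\<^bsub>C\<^esub> \<Theta> U) \<boxtimes>\<^bsub>T\<^esub> g) \<cdot>\<^bsub>C\<^esub> b U V W =
    (f \<boxtimes>\<^bsub>T\<^esub> g) \<cdot>\<^bsub>C\<^esub> (a U V W \<cdot>\<^bsub>C\<^esub> (Ident C (U \<otimes>\<^bsub>T\<^esub> V) \<boxtimes>\<^bsub>T\<^esub> \<Theta> W))"
  using assms by (simp add: b_square[symmetric] interchange_Comp)

text \<open>
  Both composites become \<open>a \<circ> ((f \<boxtimes> g) \<boxtimes> (\<Theta> \<circ> h))\<close> when followed by the isomorphism \<open>\<Theta> \<boxtimes> id\<close>.
\<close>

lemma b_natural:
  assumes [simp]: "f \<in> Arr C" "g \<in> Arr C" "h \<in> Arr C"
  shows "b (Cod C f) (Cod C g) (Cod C h) \<cdot>\<^bsub>C\<^esub> ((f \<boxtimes>\<^bsub>T\<^esub> g) \<boxtimes>\<^bsub>T\<^esub> h) =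
    (f \<boxtimes>\<^bsub>T\<^esub> (g \<boxtimes>\<^bsub>T\<^esub> h)) \<cdot>\<^bsub>C\<^esub> b (Dom C f) (Dom C g) (Dom C h)"
proof -
  note [simp] = Dom_Obj Cod_Obj
  let ?U = "Dom C f" and ?V = "Dom C g" and ?W = "Dom C h"
  let ?U' = "Cod C f" and ?V' = "Cod C g" and ?W' = "Cod C h"
  let ?t = "\<Theta> ?U' \<boxtimes>\<^bsub>T\<^esub> Ident C (?V' \<otimes>\<^bsub>T\<^esub> ?W')"
  have "?t \<cdot>\<^bsub>C\<^esub> (b ?U' ?V' ?W' \<cdot>\<^bsub>C\<^esub> ((f \<boxtimes>\<^bsub>T\<^esub> g) \<boxtimes>\<^bsub>T\<^esub> h)) =
      a ?U' ?V' ?W' \<cdot>\<^bsub>C\<^esub> ((Ident C (?U' \<otimes>\<^bsub>T\<^esub> ?V') \<boxtimes>\<^bsub>T\<^esub> \<Theta> ?W') \<cdot>\<^bsub>C\<^esub> ((f \<boxtimes>\<^bsub>T\<^esub> g) \<boxtimes>\<^bsub>T\<^esub> h))"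
    by (simp add: Comp_assoc_arr[symmetric] b_square)
  also have "\<dots> = a ?U' ?V' ?W' \<cdot>\<^bsub>C\<^esub> ((f \<boxtimes>\<^bsub>T\<^esub> g) \<boxtimes>\<^bsub>T\<^esub> (amap F h \<cdot>\<^bsub>C\<^esub> \<Theta> ?W))"
    by (simp add: interchange \<Theta>_natural)
  also have "\<dots> = a ?U' ?V' ?W' \<cdot>\<^bsub>C\<^esub> ((f \<boxtimes>\<^bsub>T\<^esub> g) \<boxtimes>\<^bsub>T\<^esub> amap F h)
      \<cdot>\<^bsub>C\<^esub> (Ident C (?U \<otimes>\<^bsub>T\<^esub> ?V) \<boxtimes>\<^bsub>T\<^esub> \<Theta> ?W)"
    by (simp add: Comp_assoc_arr interchange)
  also have "\<dots> = (amap F f \<boxtimes>\<^bsub>T\<^esub> (g \<boxtimes>\<^bsub>T\<^esub> h)) \<cdot>\<^bsub>C\<^esub> a ?U ?V ?W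
      \<cdot>\<^bsub>C\<^esub> (Ident C (?U \<otimes>\<^bsub>T\<^esub> ?V) \<boxtimes>\<^bsub>T\<^esub> \<Theta> ?W)"
    by (simp add: a_natural)
  also have "\<dots> = ((amap F f \<cdot>\<^bsub>C\<^esub> \<Theta> ?U) \<boxtimes>\<^bsub>T\<^esub> (g \<boxtimes>\<^bsub>T\<^esub> h)) \<cdot>\<^bsub>C\<^esub> b ?U ?V ?W"
    by (simp add: b_square_Comp Comp_assoc_arr)
  also have "\<dots> = ?t \<cdot>\<^bsub>C\<^esub> ((f \<boxtimes>\<^bsub>T\<^esub> (g \<boxtimes>\<^bsub>T\<^esub> h)) \<cdot>\<^bsub>C\<^esub> b ?U ?V ?W)"
    by (simp add: interchange_Comp \<Theta>_natural)
  finally show ?thesis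
    by (rule iso_cancel_left[rotated -1]) (simp_all add: is_iso_tensor is_iso_Ident)
qed

section \<open>The pentagon\<close>

text \<open>
  The \<open>\<Theta> U\<close> in the first factor of \<open>Q\<close> is the one that the square for \<open>b U V (W \<otimes> X)\<close> consumes. What
  is left of \<open>Q\<close>, moved through \<open>a\<close> (\<open>outer\<close>), is \<open>\<Theta> (U \<otimes> V)\<close>, which the square for
  \<open>b (U \<otimes> V) W X\<close> needs in turn. The \<open>\<Theta> (W \<otimes> X)\<close> produced by the former square is split and moved
  through the second \<open>a\<close> (\<open>inner\<close>) to form \<open>P\<close>.
\<close>

lemma pentagon_two_arrows:
  assumes [simp]: "U \<in> Obj C" "V \<in> Obj C" "W \<in> Obj C" "X \<in> Obj C"
  shows "((\<Theta> (omap F U) \<cdot>\<^bsub>C\<^esub> \<Theta> U) \<boxtimes>\<^bsub>T\<^esub> (\<Theta> V \<boxtimes>\<^bsub>T\<^esub> Ident C (W \<otimes>\<^bsub>T\<^esub> X)))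
      \<cdot>\<^bsub>C\<^esub> (b U V (W \<otimes>\<^bsub>T\<^esub> X) \<cdot>\<^bsub>C\<^esub> b (U \<otimes>\<^bsub>T\<^esub> V) W X) =
    a (omap F U) (omap F V) (W \<otimes>\<^bsub>T\<^esub> X) \<cdot>\<^bsub>C\<^esub> a (U \<otimes>\<^bsub>T\<^esub> V) (omap F W) (omap F X)
      \<cdot>\<^bsub>C\<^esub> ((Ident C (U \<otimes>\<^bsub>T\<^esub> V) \<boxtimes>\<^bsub>T\<^esub> \<Theta> W) \<boxtimes>\<^bsub>T\<^esub> (\<Theta> (omap F X) \<cdot>\<^bsub>C\<^esub> \<Theta> X))"
proof -
  note [simp] = F_tensor_obj
  let ?UV = "U \<otimes>\<^bsub>T\<^esub> V" and ?WX = "W \<otimes>\<^bsub>T\<^esub> X"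
  let ?a = "a (omap F U) (omap F V) ?WX"
  have outer: "(\<Theta> (omap F U) \<boxtimes>\<^bsub>T\<^esub> (\<Theta> V \<boxtimes>\<^bsub>T\<^esub> Ident C ?WX)) \<cdot>\<^bsub>C\<^esub> a U V ?WX =
      ?a \<cdot>\<^bsub>C\<^esub> (\<Theta> ?UV \<boxtimes>\<^bsub>T\<^esub> Ident C (omap F ?WX))"
    using a_natural[of "\<Theta> U" "\<Theta> V" "Ident C ?WX" U V ?WX]
    by (simp add: F_\<Theta> \<Theta>_tensor F.amap_Ident del: tensor_Ident)
  have inner: "(Ident C (omap F ?UV) \<boxtimes>\<^bsub>T\<^esub> \<Theta> ?WX) \<cdot>\<^bsub>C\<^esub> a ?UV W X =
      a ?UV (omap F W) (omap F X) \<cdot>\<^bsub>C\<^esub> ((Ident C ?UV \<boxtimes>\<^bsub>T\<^esub> \<Theta> W) \<boxtimes>\<^bsub>T\<^esub> \<Theta> (omap F X))"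
    using a_natural[of "Ident C ?UV" "\<Theta> W" "\<Theta> X" ?UV W X]
    by (simp add: F_\<Theta> \<Theta>_tensor F.amap_Ident del: tensor_Ident)
  have "((\<Theta> (omap F U) \<cdot>\<^bsub>C\<^esub> \<Theta> U) \<boxtimes>\<^bsub>T\<^esub> (\<Theta> V \<boxtimes>\<^bsub>T\<^esub> Ident C ?WX))
      \<cdot>\<^bsub>C\<^esub> (b U V ?WX \<cdot>\<^bsub>C\<^esub> b ?UV W X) =
      (\<Theta> (omap F U) \<boxtimes>\<^bsub>T\<^esub> (\<Theta> V \<boxtimes>\<^bsub>T\<^esub> Ident C ?WX)) \<cdot>\<^bsub>C\<^esub> a U V ?WX
      \<cdot>\<^bsub>C\<^esub> ((Ident C ?UV \<boxtimes>\<^bsub>T\<^esub> \<Theta> ?WX) \<cdot>\<^bsub>C\<^esub> b ?UV W X)"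
    by (simp add: Comp_assoc_arr[symmetric] b_square_Comp)
  also have "\<dots> = ?a \<cdot>\<^bsub>C\<^esub> ((\<Theta> ?UV \<boxtimes>\<^bsub>T\<^esub> \<Theta> ?WX) \<cdot>\<^bsub>C\<^esub> b ?UV W X)"
    unfolding outer by (simp add: Comp_assoc_arr interchange_Comp)
  also have "\<dots> = ?a \<cdot>\<^bsub>C\<^esub> ((Ident C (omap F ?UV) \<boxtimes>\<^bsub>T\<^esub> \<Theta> ?WX) \<cdot>\<^bsub>C\<^esub> a ?UV W X
      \<cdot>\<^bsub>C\<^esub> (Ident C (?UV \<otimes>\<^bsub>T\<^esub> W) \<boxtimes>\<^bsub>T\<^esub> \<Theta> X))"
    using b_square_Comp[of ?UV W X "Ident C (omap F ?UV)" "\<Theta> ?WX"] by (simp add: Comp_assoc_arr)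
  also have "\<dots> = ?a \<cdot>\<^bsub>C\<^esub> a ?UV (omap F W) (omap F X)
      \<cdot>\<^bsub>C\<^esub> ((Ident C ?UV \<boxtimes>\<^bsub>T\<^esub> \<Theta> W) \<boxtimes>\<^bsub>T\<^esub> (\<Theta> (omap F X) \<cdot>\<^bsub>C\<^esub> \<Theta> X))"
    unfolding inner by (simp add: Comp_assoc_arr interchange)
  finally show ?thesis .
qed

text \<open>
  Here the second factor of \<open>Q\<close> serves the square for \<open>b V W X\<close>, and the two copies of \<open>\<Theta>\<close> in the
  first factor serve \<open>b U (V \<otimes> W) X\<close> and, after passing \<open>a\<close> (\<open>middle\<close>), \<open>b U V W\<close>. The first two
  squares each emit a \<open>\<Theta>\<close> on \<open>X\<close>, which together make the last factor of \<open>P\<close>.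
\<close>

lemma pentagon_three_arrows:
  assumes [simp]: "U \<in> Obj C" "V \<in> Obj C" "W \<in> Obj C" "X \<in> Obj C"
  shows "((\<Theta> (omap F U) \<cdot>\<^bsub>C\<^esub> \<Theta> U) \<boxtimes>\<^bsub>T\<^esub> (\<Theta> V \<boxtimes>\<^bsub>T\<^esub> Ident C (W \<otimes>\<^bsub>T\<^esub> X)))
      \<cdot>\<^bsub>C\<^esub> ((Ident C U \<boxtimes>\<^bsub>T\<^esub> b V W X) \<cdot>\<^bsub>C\<^esub> b U (V \<otimes>\<^bsub>T\<^esub> W) X \<cdot>\<^bsub>C\<^esub> (b U V W \<boxtimes>\<^bsub>T\<^esub> Ident C X)) =
    (Ident C (omap F (omap F U)) \<boxtimes>\<^bsub>T\<^esub> a V W X)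
      \<cdot>\<^bsub>C\<^esub> a (omap F U) (V \<otimes>\<^bsub>T\<^esub> W) (omap F X)
      \<cdot>\<^bsub>C\<^esub> (a U V W \<boxtimes>\<^bsub>T\<^esub> Ident C (omap F (omap F X)))
      \<cdot>\<^bsub>C\<^esub> ((Ident C (U \<otimes>\<^bsub>T\<^esub> V) \<boxtimes>\<^bsub>T\<^esub> \<Theta> W) \<boxtimes>\<^bsub>T\<^esub> (\<Theta> (omap F X) \<cdot>\<^bsub>C\<^esub> \<Theta> X))"
proof -
  let ?FU = "omap F U" and ?FX = "omap F X" and ?VW = "V \<otimes>\<^bsub>T\<^esub> W"
  let ?a = "Ident C (omap F ?FU) \<boxtimes>\<^bsub>T\<^esub> a V W X"
  have middle: "(\<Theta> ?FU \<boxtimes>\<^bsub>T\<^esub> (Ident C ?VW \<boxtimes>\<^bsub>T\<^esub> \<Theta> X)) \<cdot>\<^bsub>C\<^esub> a U ?VW X =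
      a ?FU ?VW ?FX \<cdot>\<^bsub>C\<^esub> ((\<Theta> U \<boxtimes>\<^bsub>T\<^esub> Ident C ?VW) \<boxtimes>\<^bsub>T\<^esub> \<Theta> ?FX)"
    using a_natural[of "\<Theta> U" "Ident C ?VW" "\<Theta> X" U ?VW X] by (simp add: F_\<Theta> del: tensor_Ident)
  have "((\<Theta> ?FU \<cdot>\<^bsub>C\<^esub> \<Theta> U) \<boxtimes>\<^bsub>T\<^esub> (\<Theta> V \<boxtimes>\<^bsub>T\<^esub> Ident C (W \<otimes>\<^bsub>T\<^esub> X)))
      \<cdot>\<^bsub>C\<^esub> ((Ident C U \<boxtimes>\<^bsub>T\<^esub> b V W X) \<cdot>\<^bsub>C\<^esub> b U ?VW X \<cdot>\<^bsub>C\<^esub> (b U V W \<boxtimes>\<^bsub>T\<^esub> Ident C X)) =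
      ((\<Theta> ?FU \<cdot>\<^bsub>C\<^esub> \<Theta> U) \<boxtimes>\<^bsub>T\<^esub> (a V W X \<cdot>\<^bsub>C\<^esub> (Ident C ?VW \<boxtimes>\<^bsub>T\<^esub> \<Theta> X)))
      \<cdot>\<^bsub>C\<^esub> (b U ?VW X \<cdot>\<^bsub>C\<^esub> (b U V W \<boxtimes>\<^bsub>T\<^esub> Ident C X))"
    by (simp add: Comp_assoc_arr interchange_Comp b_square)
  also have "\<dots> = ?a \<cdot>\<^bsub>C\<^esub> (((\<Theta> ?FU \<cdot>\<^bsub>C\<^esub> \<Theta> U) \<boxtimes>\<^bsub>T\<^esub> (Ident C ?VW \<boxtimes>\<^bsub>T\<^esub> \<Theta> X)) \<cdot>\<^bsub>C\<^esub> b U ?VW X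
      \<cdot>\<^bsub>C\<^esub> (b U V W \<boxtimes>\<^bsub>T\<^esub> Ident C X))"
    by (simp add: Comp_assoc_arr interchange_Comp)
  also have "\<dots> = ?a \<cdot>\<^bsub>C\<^esub> ((\<Theta> ?FU \<boxtimes>\<^bsub>T\<^esub> (Ident C ?VW \<boxtimes>\<^bsub>T\<^esub> \<Theta> X)) \<cdot>\<^bsub>C\<^esub> a U ?VW X
      \<cdot>\<^bsub>C\<^esub> ((Ident C (U \<otimes>\<^bsub>T\<^esub> ?VW) \<boxtimes>\<^bsub>T\<^esub> \<Theta> X) \<cdot>\<^bsub>C\<^esub> (b U V W \<boxtimes>\<^bsub>T\<^esub> Ident C X)))"
    by (simp add: Comp_assoc_arr b_square_Comp)
  also have "\<dots> = ?a \<cdot>\<^bsub>C\<^esub> (a ?FU ?VW ?FX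
      \<cdot>\<^bsub>C\<^esub> (((\<Theta> U \<boxtimes>\<^bsub>T\<^esub> Ident C ?VW) \<cdot>\<^bsub>C\<^esub> b U V W) \<boxtimes>\<^bsub>T\<^esub> (\<Theta> ?FX \<cdot>\<^bsub>C\<^esub> \<Theta> X)))"
    unfolding middle by (simp add: Comp_assoc_arr interchange)
  also have "\<dots> = ?a \<cdot>\<^bsub>C\<^esub> (a ?FU ?VW ?FX
      \<cdot>\<^bsub>C\<^esub> ((a U V W \<cdot>\<^bsub>C\<^esub> (Ident C (U \<otimes>\<^bsub>T\<^esub> V) \<boxtimes>\<^bsub>T\<^esub> \<Theta> W)) \<boxtimes>\<^bsub>T\<^esub> (\<Theta> ?FX \<cdot>\<^bsub>C\<^esub> \<Theta> X)))"
    by (simp only: b_square assms)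
  also have "\<dots> = ?a \<cdot>\<^bsub>C\<^esub> a ?FU ?VW ?FX \<cdot>\<^bsub>C\<^esub> (a U V W \<boxtimes>\<^bsub>T\<^esub> Ident C (omap F ?FX))
      \<cdot>\<^bsub>C\<^esub> ((Ident C (U \<otimes>\<^bsub>T\<^esub> V) \<boxtimes>\<^bsub>T\<^esub> \<Theta> W) \<boxtimes>\<^bsub>T\<^esub> (\<Theta> ?FX \<cdot>\<^bsub>C\<^esub> \<Theta> X))"
    by (simp add: Comp_assoc_arr interchange)
  finally show ?thesis .
qed

lemma b_pentagon:
  assumes [simp]: "U \<in> Obj C" "V \<in> Obj C" "W \<in> Obj C" "X \<in> Obj C"
  shows "b U V (W \<otimes>\<^bsub>T\<^esub> X) \<cdot>\<^bsub>C\<^esub> b (U \<otimes>\<^bsub>T\<^esub> V) W X =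
    (Ident C U \<boxtimes>\<^bsub>T\<^esub> b V W X) \<cdot>\<^bsub>C\<^esub> b U (V \<otimes>\<^bsub>T\<^esub> W) X \<cdot>\<^bsub>C\<^esub> (b U V W \<boxtimes>\<^bsub>T\<^esub> Ident C X)"
proof (rule iso_cancel_left)
  let ?Q = "(\<Theta> (omap F U) \<cdot>\<^bsub>C\<^esub> \<Theta> U) \<boxtimes>\<^bsub>T\<^esub> (\<Theta> V \<boxtimes>\<^bsub>T\<^esub> Ident C (W \<otimes>\<^bsub>T\<^esub> X))"
  show "is_iso C ?Q"
    by (intro is_iso_tensor is_iso_Comp is_iso_Ident \<Theta>_iso) simp_all
  show "?Q \<cdot>\<^bsub>C\<^esub> (b U V (W \<otimes>\<^bsub>T\<^esub> X) \<cdot>\<^bsub>C\<^esub> b (U \<otimes>\<^bsub>T\<^esub> V) W X) =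
    ?Q \<cdot>\<^bsub>C\<^esub> ((Ident C U \<boxtimes>\<^bsub>T\<^esub> b V W X) \<cdot>\<^bsub>C\<^esub> b U (V \<otimes>\<^bsub>T\<^esub> W) X \<cdot>\<^bsub>C\<^esub> (b U V W \<boxtimes>\<^bsub>T\<^esub> Ident C X))"
    by (simp only: pentagon_two_arrows pentagon_three_arrows hom_pentagon assms)
qed simp_all

theorem b_associativity_constraint: "associativity_constraint C T b"
proof -
  interpret L: is_functor "C \<times>\<^sub>C C \<times>\<^sub>C C" C "left_bracketing T id_functor"
    by (intro functor_left_bracketing \<Phi>.source.is_functor_axioms)
  interpret R: is_functor "C \<times>\<^sub>C C \<times>\<^sub>C C" C "right_bracketing T id_functor"
    by (intro functor_right_bracketing \<Phi>.source.is_functor_axioms)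
  show ?thesis
  proof unfold_locales
    fix X assume "X \<in> Obj (C \<times>\<^sub>C C \<times>\<^sub>C C)"
    then show "(case X of (U, V, W) \<Rightarrow> b U V W) \<in>
        Hom C (omap (left_bracketing T id_functor) X) (omap (right_bracketing T id_functor) X)"
      and "is_iso C (case X of (U, V, W) \<Rightarrow> b U V W)"
      by (auto simp: left_bracketing_def right_bracketing_def id_functor_def Hom_def b_iso)
  next
    fix k X Y assume "k \<in> Hom (C \<times>\<^sub>C C \<times>\<^sub>C C) X Y"
    then show "(case Y of (U, V, W) \<Rightarrow> b U V W) \<cdot>\<^bsub>C\<^esub> amap (left_bracketing T id_functor) k =
        amap (right_bracketing T id_functor) k \<cdot>\<^bsub>C\<^esub> (case X of (U, V, W) \<Rightarrow> b U V W)"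
      by (cases k, cases X, cases Y)
        (auto simp: Hom_prod_cat left_bracketing_def right_bracketing_def id_functor_def,
         auto simp: Hom_def b_natural)
  qed (rule b_pentagon)
qed

end

theorem proposition8p1:
  fixes C :: "('o, 'm) cat"
    and T :: "('o \<times> 'o, 'm \<times> 'm, 'o, 'm) functor_data"
    and F G :: "('o, 'm, 'o, 'm) functor_data"
    and a b :: "'o \<Rightarrow> 'o \<Rightarrow> 'o \<Rightarrow> 'm"
    and \<Phi> \<Theta> :: "'o \<Rightarrow> 'm"
  assumes "hom_tensor_category C T F G a \<Phi>"
    and "natural_isomorphism C C id_functor F \<Theta>"
    and "\<And>M N. M \<in> Obj C \<Longrightarrow> N \<in> Obj C \<Longrightarrow> \<Theta> (M \<otimes>\<^bsub>T\<^esub> N) = \<Theta> M \<boxtimes>\<^bsub>T\<^esub> \<Theta> N"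
    and "\<And>U V W. U \<in> Obj C \<Longrightarrow> V \<in> Obj C \<Longrightarrow> W \<in> Obj C \<Longrightarrow>
      b U V W = (inv_arr C (\<Theta> U) \<boxtimes>\<^bsub>T\<^esub> Ident C (V \<otimes>\<^bsub>T\<^esub> W))
        \<cdot>\<^bsub>C\<^esub> a U V W \<cdot>\<^bsub>C\<^esub> (Ident C (U \<otimes>\<^bsub>T\<^esub> V) \<boxtimes>\<^bsub>T\<^esub> \<Theta> W)"
  shows "associativity_constraint C T b \<and> pre_tensor_category C T b"
proof -
  interpret untwisted_hom_tensor_category C T F G a \<Phi> \<Theta> b
    by (intro untwisted_hom_tensor_category.intro untwisted_hom_tensor_category_axioms.intro assms)
  show ?thesis
    using b_associativity_constraint
    by (intro conjI pre_tensor_category.intro category_axioms tensor.is_functor_axioms)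
qed

end
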